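(* Let $\alpha$ be any real constant and let $\tau=\log^* n$. Any non-adaptive randomized algorithm that, with probability at least $2/3$, $\alpha$-estimates the number of defective items in a set of $n$ items must make at least $$\Omega\left(\frac{\log n}{(480\,\tau)^{\tau+1}}\right)$$ tests. Here $\Omega(\cdot)$ is as $n\to\infty$: there exist $c>0$ and $n_0$, depending only on $\alpha$, such that for all $n\ge n_0$ any such algorithm makes at least $c\,\log n/(480\,\tau)^{\tau+1}$ tests on $n$ items.
   Context: Group testing. The set of items is $X=[n]=\{1,\dots,n\}$ and an unknown set $I\subseteq X$ is the set of defective items. A test is a subset $Q\subseteq X$; its answer is $\mathcal{O}_I(Q)=1$ if $Q\cap I\neq\emptyset$ and $\mathcal{O}_I(Q)=0$ otherwise. The algorithm knows $n$ and accesses $I$ only through the test oracle $\mathcal{O}_I$. A randomized algorithm is non-adaptive if its tests do not depend on the answers to other tests. That is, using its random seed only (and $n$), it chooses a (random) collection of tests $Q_1,\dots,Q_s$, receives all the answers $\mathcal{O}_I(Q_1),\dots,\mathcal{O}_I(Q_s)$ simultaneously, and produces an output depending on the seed and these answers. The number of tests it makes is $s=s(n)$. An algorithm $A$, with probability at least $1-\delta$, $\alpha$-estimates the number of defective items if, for every $I\subseteq X$, $A$ runs in time polynomial in $n$, makes tests with the oracle $\mathcal{O}_I$, and, with probability at least $1-\delta$ (over its own randomness), returns an integer $D$ such that $|I|\le D\le\alpha|I|$. Logarithms are to base 2. Write $\log^{[0]}n=n$ and $\log^{[k]}n=\log(\log^{[k-1]}n)$ for $k\ge1$ (the $k$-fold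 iterated logarithm). $\log^* n$ is the smallest integer $k$ such that $\log^{[k]}n<2$. *)

theory Defs
  imports "HOL-Probability.Probability"
begin

definition items :: "nat \<Rightarrow> nat set" where
  "items n = {1..n}"

text \<open>The oracle for the defective set \<open>I\<close>; \<open>True\<close> stands for the answer 1.\<close>

definition test_answer :: "nat set \<Rightarrow> nat set \<Rightarrow> bool" where
  "test_answer I Q \<longleftrightarrow> Q \<inter> I \<noteq> {}"

text \<open>
  The seed is an infinite bit string with an arbitrary distribution. A fixed seed type, rather
  than a type parameter, allows quantification over algorithms inside a formula. Non-adaptivity is
  built into the types: a test depends on \<open>n\<close>, the seed and its own index only, and \<open>I\<close> enters the
  returned value only through the list of all answers. No bound on the running time is imposed.
\<close>

type_synonym seed = "nat \<Rightarrow> bool"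

record nonadaptive_alg =
  seed_dist :: "seed measure"
  num_tests :: "nat \<Rightarrow> nat"
  test :: "nat \<Rightarrow> seed \<Rightarrow> nat \<Rightarrow> nat set"
  result :: "nat \<Rightarrow> seed \<Rightarrow> bool list \<Rightarrow> int"

definition nonadaptive_randomized :: "nat \<Rightarrow> nonadaptive_alg \<Rightarrow> bool" where
  "nonadaptive_randomized n A \<longleftrightarrow>
     prob_space (seed_dist A) \<and>
     (\<forall>r \<in> space (seed_dist A). \<forall>i < num_tests A n. test A n r i \<subseteq> items n)"

definition run :: "nonadaptive_alg \<Rightarrow> nat \<Rightarrow> nat set \<Rightarrow> seed \<Rightarrow> int" where
  "run A n I r =
     result A n r (map (\<lambda>i. test_answer I (test A n r i)) [0..<num_tests A n])"

text \<open>
  Since \<open>measure\<close> is 0 on non-measurable sets, for \<open>p > 0\<close> the inequality below also says that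
  the event of a correct output is measurable.
\<close>

definition estimates_with_prob :: "real \<Rightarrow> real \<Rightarrow> nat \<Rightarrow> nonadaptive_alg \<Rightarrow> bool" where
  "estimates_with_prob p \<alpha> n A \<longleftrightarrow>
     (\<forall>I \<subseteq> items n.
        measure (seed_dist A)
          {r \<in> space (seed_dist A).
             real (card I) \<le> real_of_int (run A n I r) \<and>
             real_of_int (run A n I r) \<le> \<alpha> * real (card I)} \<ge> p)"

definition iter_log :: "nat \<Rightarrow> real \<Rightarrow> real" where
  "iter_log k = (log 2 ^^ k)"

definition log_star :: "real \<Rightarrow> nat" where
  "log_star x = (LEAST k. iter_log k x < 2)"

end

(*
  Along a nested chain I_0 <= I_1 <= ... of defective sets and for a fixed seed, the set of positive
  tests only grows, so s tests see at most s + 1 answer vectors. If the sizes |I_j| = B^j grow by a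
  factor B > alpha, then one returned value is correct for at most one j, so each seed is correct on
  at most s + 1 members of the chain. Averaging over the seed, success probability 2/3 on all m
  members forces 2m/3 <= s + 1, and m can be taken about log n / log B. This is even an Omega(log n)
  bound; the denominator (480 tau)^(tau+1) is at least 1, or 0 (and the quotient is then 0) for
  tau = 0.
*)
theory Submission
  imports Defs
begin

definition correct :: "real \<Rightarrow> nonadaptive_alg \<Rightarrow> nat \<Rightarrow> nat set \<Rightarrow> seed \<Rightarrow> bool" where
  "correct \<alpha> A n I r \<longleftrightarrow>
     real (card I) \<le> real_of_int (run A n I r) \<and> real_of_int (run A n I r) \<le> \<alpha> * real (card I)"

text \<open>The answer vector encoded as a set of indices, so that enlarging the defective set
  becomes inclusion and vectors along a chain can be compared by cardinality.\<close>

definition positive_tests :: "nonadaptive_alg \<Rightarrow> nat \<Rightarrow> seed \<Rightarrow> nat set \<Rightarrow> nat set" where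
  "positive_tests A n r I = {i. i < num_tests A n \<and> test_answer I (test A n r i)}"

lemma positive_tests_mono: "I \<subseteq> I' \<Longrightarrow> positive_tests A n r I \<subseteq> positive_tests A n r I'"
  by (auto simp: positive_tests_def test_answer_def)

lemma finite_positive_tests: "finite (positive_tests A n r I)"
  by (simp add: positive_tests_def)

lemma card_positive_tests_le: "card (positive_tests A n r I) \<le> num_tests A n"
  using card_mono[of "{..<num_tests A n}" "positive_tests A n r I"]
  by (auto simp: positive_tests_def)

text \<open>For a fixed seed, the defective set reaches \<open>result\<close> only through the
  answer list, and the set of positive indices determines that list.\<close>

lemma run_cong_positive_tests:
  assumes "positive_tests A n r I = positive_tests A n r I'"
  shows "run A n I r = run A n I' r"
proof -
  have "test_answer I (test A n r i) = test_answer I' (test A n r i)" if "i < num_tests A n" for i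
  proof -
    have "i \<in> positive_tests A n r I \<longleftrightarrow> i \<in> positive_tests A n r I'"
      by (simp only: assms)
    with that show ?thesis
      by (simp add: positive_tests_def)
  qed
  then have "map (\<lambda>i. test_answer I (test A n r i)) [0..<num_tests A n] =
             map (\<lambda>i. test_answer I' (test A n r i)) [0..<num_tests A n]"
    by simp
  then show ?thesis
    by (simp only: run_def)
qed

text \<open>The number of positive tests maps the correct indices injectively into
  \<open>{..num_tests A n}\<close>: nested finite sets of equal size coincide, so two indices with
  the same count share one returned value, and \<open>gap\<close> keeps it from being correct for
  both.\<close>

lemma card_correct_chain_le:
  fixes I :: "nat \<Rightarrow> nat set"
  assumes chain: "\<And>j k. j \<le> k \<Longrightarrow> I j \<subseteq> I k"
    and gap: "\<And>j k. j < k \<Longrightarrow> \<alpha> * real (card (I j)) < real (card (I k))"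
  shows "card {j \<in> {..m}. correct \<alpha> A n (I j) r} \<le> num_tests A n + 1"
proof -
  let ?J = "{j \<in> {..m}. correct \<alpha> A n (I j) r}"
  let ?P = "\<lambda>j. positive_tests A n r (I j)"
  have "inj_on (\<lambda>j. card (?P j)) ?J"
  proof (rule linorder_inj_onI')
    fix j k assume jk: "j \<in> ?J" "k \<in> ?J" "j < k"
    show "card (?P j) \<noteq> card (?P k)"
    proof
      assume "card (?P j) = card (?P k)"
      moreover have "?P j \<subseteq> ?P k"
        using chain jk by (intro positive_tests_mono) simp
      ultimately have "?P j = ?P k"
        by (intro card_subset_eq finite_positive_tests)
      then have "run A n (I j) r = run A n (I k) r"
        by (rule run_cong_positive_tests)
      moreover have "real (card (I k)) \<le> real_of_int (run A n (I k) r)"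
          "real_of_int (run A n (I j) r) \<le> \<alpha> * real (card (I j))"
        using jk(1,2) by (simp_all add: correct_def)
      ultimately show False
        using gap[OF jk(3)] by linarith
    qed
  qed
  moreover have "(\<lambda>j. card (?P j)) ` ?J \<subseteq> {..num_tests A n}"
    by (rule image_subsetI) (simp add: card_positive_tests_le)
  ultimately have "card ?J \<le> card {..num_tests A n}"
    by (intro card_inj_on_le) simp_all
  then show ?thesis
    by simp
qed

text \<open>Double counting of pairs (seed, index) with a correct output: the expected number of
  correct indices is at least \<open>p\<close> for each of the \<open>m + 1\<close> members, while
  no seed contributes more than \<open>num_tests A n + 1\<close>.\<close>

lemma num_tests_ge_chain_length:
  assumes alg: "nonadaptive_randomized n A" "estimates_with_prob p \<alpha> n A" and p: "p > 0"
    and items: "\<And>j. j \<le> m \<Longrightarrow> I j \<subseteq> items n"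
    and chain: "\<And>j k. j \<le> k \<Longrightarrow> I j \<subseteq> I k"
    and gap: "\<And>j k. j < k \<Longrightarrow> \<alpha> * real (card (I j)) < real (card (I k))"
  shows "p * real (m + 1) \<le> real (num_tests A n + 1)"
proof -
  interpret prob_space "seed_dist A"
    using alg by (simp add: nonadaptive_randomized_def)
  define E where "E j = {r \<in> space (seed_dist A). correct \<alpha> A n (I j) r}" for j
  have prob: "p \<le> prob (E j)" if "j \<le> m" for j
    using alg(2) items[OF that] by (simp add: estimates_with_prob_def E_def correct_def)
  \<comment> \<open>A non-measurable event would have measure 0, contradicting success probability
    at least \<open>p > 0\<close>.\<close>
  have meas: "E j \<in> events" if "j \<le> m" for j
  proof (rule ccontr)
    assume "E j \<notin> events"
    then show False
      using prob[OF that] p by (simp add: measure_notin_sets)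
  qed
  have integrable: "integrable (seed_dist A) (indicator (E j) :: _ \<Rightarrow> real)" if "j \<le> m" for j
    using meas[OF that] by (simp add: emeasure_eq_measure)
  have "p * real (m + 1) = (\<Sum>j\<le>m. p)"
    by simp
  also have "\<dots> \<le> (\<Sum>j\<le>m. prob (E j))"
    using prob by (intro sum_mono) simp
  also have "\<dots> = (\<Sum>j\<le>m. expectation (indicator (E j)))"
    using meas by (intro sum.cong) (simp_all add: sets.Int_space_eq2)
  also have "\<dots> = expectation (\<lambda>r. \<Sum>j\<le>m. indicator (E j) r)"
    using integrable by (subst Bochner_Integration.integral_sum) simp_all
  also have "\<dots> \<le> expectation (\<lambda>r. real (num_tests A n + 1))"
  proof (rule integral_mono)
    show "integrable (seed_dist A) (\<lambda>r. \<Sum>j\<le>m. indicator (E j) r :: real)"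
      using integrable by (intro Bochner_Integration.integrable_sum) simp
  next
    fix r assume "r \<in> space (seed_dist A)"
    then have "(\<Sum>j\<le>m. indicator (E j) r :: real) = card {j \<in> {..m}. correct \<alpha> A n (I j) r}"
      by (simp add: indicator_def E_def sum.If_cases Int_def)
    also have "\<dots> \<le> real (num_tests A n + 1)"
      using card_correct_chain_le[OF chain gap] by (simp only: of_nat_le_iff)
    finally show "(\<Sum>j\<le>m. indicator (E j) r :: real) \<le> real (num_tests A n + 1)" .
  qed simp
  also have "\<dots> = real (num_tests A n + 1)"
    by (simp add: prob_space)
  finally show ?thesis .
qed

text \<open>The chain consists of the initial segments of size \<open>B ^ j\<close> that fit into
  \<open>items n\<close>. Starting at \<open>j = 0\<close> gives one member more than the floor of
  the logarithm, so rounding loses nothing.\<close>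

lemma num_tests_ge_log:
  assumes alg: "nonadaptive_randomized n A" "estimates_with_prob p \<alpha> n A" and p: "p > 0"
    and B: "B \<ge> 2" "\<alpha> < real B" and n: "n \<ge> 1"
  shows "p * log (real B) (real n) \<le> real (num_tests A n + 1)"
proof -
  define m where "m = nat \<lfloor>log (real B) (real n)\<rfloor>"
  have log_nonneg: "log (real B) (real n) \<ge> 0"
    using B n by simp
  have "real m \<le> log (real B) (real n)"
    using log_nonneg by (simp add: m_def)
  then have "real (B ^ m) \<le> real n"
    using B n by (simp add: le_log_iff powr_realpow)
  then have Bm: "B ^ m \<le> n"
    by (simp only: of_nat_le_iff)
  have "log (real B) (real n) \<le> real (m + 1)"
    using log_nonneg unfolding m_def by linarith
  then have "p * log (real B) (real n) \<le> p * real (m + 1)"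
    using p by simp
  also have "\<dots> \<le> real (num_tests A n + 1)"
  proof (rule num_tests_ge_chain_length[where I = "\<lambda>j. {1..B ^ j}", OF alg p])
    fix j assume "j \<le> m"
    then have "B ^ j \<le> B ^ m"
      using B by (intro power_increasing) auto
    then show "{1..B ^ j} \<subseteq> items n"
      using Bm by (auto simp: items_def)
  next
    fix j k :: nat assume "j \<le> k"
    then show "{1..B ^ j} \<subseteq> {1..B ^ k}"
      using B power_increasing[of j k B] by auto
  next
    fix j k :: nat assume "j < k"
    have "\<alpha> * real (B ^ j) < real (B ^ Suc j)"
      using B by simp
    also have "\<dots> \<le> real (B ^ k)"
      using B \<open>j < k\<close> power_increasing[of "Suc j" k B] by (simp only: of_nat_le_iff)
    finally show "\<alpha> * real (card {1..B ^ j}) < real (card {1..B ^ k})"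
      by simp
  qed
  finally show ?thesis .
qed

theorem theorem1:
  fixes \<alpha> :: real
  shows "\<exists>c>0. \<exists>n\<^sub>0. \<forall>n\<ge>n\<^sub>0. \<forall>A.
           nonadaptive_randomized n A \<and> estimates_with_prob (2 / 3) \<alpha> n A \<longrightarrow>
           real (num_tests A n) \<ge>
             c * log 2 (real n) /
               (480 * real (log_star (real n))) ^ (log_star (real n) + 1)"
proof -
  \<comment> \<open>An integer above \<open>\<alpha>\<close>, also when \<open>\<alpha>\<close> is
    negative; the maximum with 2 makes it a valid base for logarithms.\<close>
  define B where "B = max 2 (nat \<lfloor>\<alpha>\<rfloor> + 1)"
  have B: "B \<ge> 2" "\<alpha> < real B"
    unfolding B_def by simp linarith
  \<comment> \<open>The factor \<open>log 2 (real B)\<close> changes the base from \<open>B\<close>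
    to 2; 1/3 is what remains of 2/3 after the additive 1 is absorbed.\<close>
  define c where "c = 1 / (3 * log 2 (real B))"
  have c: "c > 0"
    using B by (simp add: c_def)
  have "c * log 2 (real n) / (480 * real \<tau>) ^ (\<tau> + 1) \<le> real (num_tests A n)"
    \<comment> \<open>The threshold \<open>B ^ 3\<close> makes a third of the base-\<open>B\<close>
      logarithm at least 1, which pays for the additive 1. The number \<open>\<tau>\<close> is
      arbitrary here and becomes \<open>log_star (real n)\<close> at the end.\<close>
    if n: "n \<ge> B ^ 3" and alg: "nonadaptive_randomized n A" "estimates_with_prob (2 / 3) \<alpha> n A"
    for n A \<tau>
  proof -
    have "1 \<le> B ^ 3"
      using B by simp
    with n have n1: "n \<ge> 1"
      by linarith
    have "real (B ^ 3) \<le> real n"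
      using n by (simp only: of_nat_le_iff)
    then have "3 \<le> log (real B) (real n)"
      using B n1 by (simp add: le_log_iff)
    moreover have "2 / 3 * log (real B) (real n) \<le> real (num_tests A n + 1)"
      by (rule num_tests_ge_log[OF alg _ B n1]) simp
    ultimately have "1 / 3 * log (real B) (real n) \<le> real (num_tests A n)"
      by simp
    moreover have "c * log 2 (real n) = 1 / 3 * log (real B) (real n)"
      using B by (simp add: c_def log_def)
    ultimately have bound: "c * log 2 (real n) \<le> real (num_tests A n)"
      by simp
    show ?thesis
    proof (cases "\<tau> = 0")
      case False
      then have "1 \<le> (480 * real \<tau>) ^ (\<tau> + 1)"
        by (intro one_le_power) simp
      moreover have "0 \<le> c * log 2 (real n)"
        using c n1 by simp
      ultimately have "c * log 2 (real n) / (480 * real \<tau>) ^ (\<tau> + 1) \<le> c * log 2 (real n) / 1"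
        using False by (intro divide_left_mono mult_pos_pos) simp_all
      also have "\<dots> \<le> real (num_tests A n)"
        using bound by simp
      finally show ?thesis .
    \<comment> \<open>For \<open>\<tau> = 0\<close> the denominator is 0, and division by 0 yields
      0.\<close>
    qed simp
  qed
  then show ?thesis
    using c by (intro exI[of _ c] exI[of _ "B ^ 3"] conjI allI impI) simp_all
qed

end
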